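(* For every integer $n\ge13$, $g_{\Pi(n)}(2n)>0$ if and only if at least one of the following holds: $2n-1$ is prime; or there exist primes $q_1,q_2>\sqrt{2n}$ such that $q_1+q_2=2n$.
   Context: For $n\ge13$, $\Pi(n)=\prod_{p\ \mathrm{prime},\ 5\le p\le\sqrt{2n}}p$. For a squarefree product $P$ of (at least one) primes $\ge5$ and a positive integer $n$, $g_P(2n)$ is the number of pairs $(h,k)\in\mathbb Z_{>0}^2$ with $h+k=2n$, $h\le k$, $\gcd(h,6P)=\gcd(k,6P)=1$. The quantity $g_{\Pi(n)}(2n)$ is obtained, for each $n$, by taking $P=\Pi(n)$. *)

theory Defs
  imports Complex_Main "HOL-Computational_Algebra.Primes"
begin

definition prime_prod :: "nat \<Rightarrow> nat" where
  "prime_prod n = (\<Prod>p | prime p \<and> 5 \<le> p \<and> real p \<le> sqrt (real (2 * n)). p)"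

(* The mathematical g_P is defined for squarefree P > 1 whose prime factors are all at least 5
   and for even positive arguments, so g_P(2n) is "goldbach_count P (2 * n)"; the definition is
   total and the set is finite for every m. *)
definition goldbach_count :: "nat \<Rightarrow> nat \<Rightarrow> nat" where
  "goldbach_count P m =
     card {(h, k). 0 < h \<and> 0 < k \<and> h + k = m \<and> h \<le> k
                   \<and> gcd h (6 * P) = 1 \<and> gcd k (6 * P) = 1}"

end

theory Submission
  imports Defs
begin

text \<open>Since 2 and 3 lie below \<open>sqrt (2 * n)\<close>, the primes dividing \<open>6 * prime_prod n\<close> are exactly
  those at most \<open>sqrt (2 * n)\<close>. A number below \<open>2 * n\<close> free of such prime factors is 1 or a
  prime exceeding \<open>sqrt (2 * n)\<close>, so the counted pairs are \<open>(1, 2 * n - 1)\<close>, when its second entry is prime, and the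
  decompositions of \<open>2 * n\<close> into two large primes.\<close>

lemma finite_primes_le_sqrt: "finite {p::nat. prime p \<and> 5 \<le> p \<and> real p \<le> sqrt x}"
proof (rule finite_subset)
  show "{p::nat. prime p \<and> 5 \<le> p \<and> real p \<le> sqrt x} \<subseteq> {..nat \<lfloor>sqrt x\<rfloor>}"
    by (auto intro: le_nat_floor)
qed simp

lemma prime_less_5_cases:
  fixes p :: nat
  assumes "prime p" "p < 5"
  shows "p = 2 \<or> p = 3"
proof -
  have "\<not> prime (4 :: nat)"
    using prime_product[of 2 2] by auto
  with assms show ?thesis
    using prime_ge_2_nat[of p] by (cases "p = 4") auto
qed

text \<open>The factor 6 supplies the primes 2 and 3 left out of the product. A prime dividing a
  product of distinct primes must equal one of them.\<close>

lemma prime_dvd_six_prime_prod_iff: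
  assumes "n \<ge> 5" "prime p"
  shows "p dvd 6 * prime_prod n \<longleftrightarrow> real p \<le> sqrt (real (2 * n))"
proof -
  \<comment> \<open>From \<open>n \<ge> 5\<close> comes 9 \<le> 2n, so 2 and 3 also satisfy the
    bound on the right-hand side.\<close>
  have three_le: "3 \<le> sqrt (real (2 * n))"
    using assms(1) by (intro real_le_rsqrt) simp
  have "p dvd 6 \<longleftrightarrow> p = 2 \<or> p = 3"
  proof -
    have "p dvd 2 * 3 \<longleftrightarrow> p dvd 2 \<or> p dvd 3"
      using assms(2) by (rule prime_dvd_mult_iff)
    moreover have "p dvd 2 \<longleftrightarrow> p = 2" "p dvd 3 \<longleftrightarrow> p = 3"
      using assms(2) primes_dvd_imp_eq[of p 2] primes_dvd_imp_eq[of p 3] by auto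
    ultimately show ?thesis by simp
  qed
  moreover have "p dvd prime_prod n \<longleftrightarrow> 5 \<le> p \<and> real p \<le> sqrt (real (2 * n))"
    unfolding prime_prod_def
    by (subst prime_dvd_prod_iff[OF finite_primes_le_sqrt assms(2)])
      (use assms(2) in \<open>auto dest: primes_dvd_imp_eq\<close>)
  moreover have "p = 2 \<or> p = 3 \<or> 5 \<le> p"
    using prime_less_5_cases[OF assms(2)] by linarith
  ultimately show ?thesis
    using three_le assms(2) by (auto simp: prime_dvd_mult_iff)
qed

text \<open>In a nontrivial factorisation of \<open>h\<close> the smaller factor has square at most
  \<open>h\<close>, and any prime dividing it serves.\<close>

lemma prime_factor_le_sqrt:
  fixes h :: nat
  assumes "1 < h" "\<not> prime h"
  obtains p where "prime p" "p dvd h" "real p \<le> sqrt (real h)"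
proof -
  obtain a b where h: "h = a * b" "1 < a" "1 < b"
  proof -
    obtain a where a: "a dvd h" "a \<noteq> 1" "a \<noteq> h"
      using assms by (auto simp: prime_nat_iff)
    then obtain b where b: "h = a * b" by (elim dvdE)
    then have "a \<noteq> 0" "b \<noteq> 0" "b \<noteq> 1" using a assms(1) by (auto intro: gr0I)
    with a b show thesis by (intro that[of a b]) linarith+
  qed
  \<comment> \<open>Stated for arbitrary \<open>c\<close> and \<open>d\<close> so that it applies to
    \<open>a\<close> and \<open>b\<close> in either order.\<close>
  have factor_if_le: thesis if "c * d = h" "c \<le> d" "1 < c" for c d
  proof -
    obtain p where p: "prime p" "p dvd c"
      using \<open>1 < c\<close> prime_factor_nat[of c] by auto
    have "p \<le> c"
      using p \<open>1 < c\<close> by (intro dvd_imp_le) auto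
    then have "p * p \<le> h"
      using that by (metis le_trans mult_le_mono)
    then have "(real p)\<^sup>2 \<le> real h"
      by (simp add: power2_eq_square flip: of_nat_mult)
    then have "real p \<le> sqrt (real h)"
      by (rule real_le_rsqrt)
    with p that(1) show thesis
      using \<open>\<And>p. prime p \<Longrightarrow> p dvd h \<Longrightarrow> real p \<le> sqrt (real h) \<Longrightarrow> thesis\<close> by auto
  qed
  show thesis
    using factor_if_le[of a b] factor_if_le[of b a] h by (cases "a \<le> b") (auto simp: mult.commute)
qed

lemma coprime_six_prime_prod_iff:
  assumes "n \<ge> 5" "0 < h" "h < 2 * n"
  shows "coprime h (6 * prime_prod n) \<longleftrightarrow> h = 1 \<or> prime h \<and> sqrt (real (2 * n)) < real h"
proof
  assume coprime: "coprime h (6 * prime_prod n)"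
  \<comment> \<open>For prime \<open>h\<close> this is applied to \<open>p = h\<close>; for
    composite \<open>h\<close> it contradicts the existence of a prime factor at most
    \<open>sqrt h\<close>, which is where \<open>h < 2 * n\<close> enters.\<close>
  have large: "sqrt (real (2 * n)) < real p" if "prime p" "p dvd h" for p
  proof -
    have "\<not> p dvd 6 * prime_prod n"
      using coprime_common_divisor[OF coprime that(2)] that(1) not_prime_unit by blast
    then show ?thesis
      using prime_dvd_six_prime_prod_iff[OF assms(1) that(1)] by linarith
  qed
  show "h = 1 \<or> prime h \<and> sqrt (real (2 * n)) < real h"
  proof (cases "h = 1 \<or> prime h")
    case True
    then show ?thesis using large by auto
  next
    case False
    then obtain p where p: "prime p" "p dvd h" "real p \<le> sqrt (real h)"
      using prime_factor_le_sqrt[of h] assms(2) by auto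
    moreover have "sqrt (real h) \<le> sqrt (real (2 * n))"
      using assms(3) by simp
    ultimately show ?thesis using large[of p] by linarith
  qed
next
  assume "h = 1 \<or> prime h \<and> sqrt (real (2 * n)) < real h"
  then show "coprime h (6 * prime_prod n)"
  proof (elim disjE conjE)
    assume "prime h" "sqrt (real (2 * n)) < real h"
    then show ?thesis
      using prime_dvd_six_prime_prod_iff[OF assms(1), of h]
      by (intro prime_imp_coprime) linarith+
  qed simp
qed

text \<open>The remaining conditions are symmetric in \<open>h\<close> and \<open>k\<close>, so the
  ordering \<open>h \<le> k\<close> affects how many pairs there are but not whether one
  exists.\<close>

lemma goldbach_count_pos_iff:
  "goldbach_count P m > 0 \<longleftrightarrow>
    (\<exists>h k. 0 < h \<and> 0 < k \<and> h + k = m \<and> coprime h (6 * P) \<and> coprime k (6 * P))"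
proof -
  let ?S = "{(h, k). 0 < h \<and> 0 < k \<and> h + k = m \<and> h \<le> k
                   \<and> gcd h (6 * P) = 1 \<and> gcd k (6 * P) = 1}"
  \<comment> \<open>An infinite set would have \<open>card\<close> 0, so nonemptiness gives
    positivity only for a finite set.\<close>
  have "finite ?S"
    by (rule finite_subset[of _ "{..m} \<times> {..m}"]) auto
  then have "goldbach_count P m > 0 \<longleftrightarrow> ?S \<noteq> {}"
    unfolding goldbach_count_def by (simp only: card_gt_0_iff simp_thms)
  also have "\<dots> \<longleftrightarrow> (\<exists>h k. 0 < h \<and> 0 < k \<and> h + k = m \<and> h \<le> k
      \<and> coprime h (6 * P) \<and> coprime k (6 * P))"
    unfolding coprime_iff_gcd_eq_1 by auto
  also have "\<dots> \<longleftrightarrow> (\<exists>h k. 0 < h \<and> 0 < k \<and> h + k = m \<and> coprime h (6 * P) \<and> coprime k (6 * P))"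
    (is "?L \<longleftrightarrow> ?R")
  proof
    assume ?R
    then obtain h k where "0 < h" "0 < k" "h + k = m" "coprime h (6 * P)" "coprime k (6 * P)"
      by blast
    \<comment> \<open>If \<open>h > k\<close>, the swapped pair is the witness.\<close>
    then show ?L
      by (cases "h \<le> k") (force, intro exI[of _ k] exI[of _ h], auto)
  qed blast
  finally show ?thesis .
qed

theorem corollary6p3:
  fixes n :: nat
  assumes "n \<ge> 13"
  shows "goldbach_count (prime_prod n) (2 * n) > 0 \<longleftrightarrow>
    prime (2 * n - 1) \<or>
    (\<exists>q1 q2 :: nat. prime q1 \<and> prime q2 \<and>
       real q1 > sqrt (real (2 * n)) \<and> real q2 > sqrt (real (2 * n)) \<and> q1 + q2 = 2 * n)"
    (is "_ \<longleftrightarrow> ?rhs")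
proof -
  have n: "n \<ge> 5" using assms by simp
  note coprime_iff = coprime_six_prime_prod_iff[OF n]
  show ?thesis
    unfolding goldbach_count_pos_iff
  proof
    assume "\<exists>h k. 0 < h \<and> 0 < k \<and> h + k = 2 * n
      \<and> coprime h (6 * prime_prod n) \<and> coprime k (6 * prime_prod n)"
    then obtain h k where hk: "0 < h" "0 < k" "h + k = 2 * n"
      and cop: "coprime h (6 * prime_prod n)" "coprime k (6 * prime_prod n)"
      by blast
    have h: "h = 1 \<or> prime h \<and> sqrt (real (2 * n)) < real h"
      using coprime_iff[of h] hk cop by linarith
    have k: "k = 1 \<or> prime k \<and> sqrt (real (2 * n)) < real k"
      using coprime_iff[of k] hk cop by linarith
    \<comment> \<open>If one entry is 1, the other is \<open>2 * n - 1\<close>, which is not 1 and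
      so must be prime; otherwise both entries are large primes.\<close>
    consider "h = 1" "k = 2 * n - 1" | "k = 1" "h = 2 * n - 1" | "h \<noteq> 1" "k \<noteq> 1"
      using hk by linarith
    then show ?rhs
      using h k hk assms by cases auto
  next
    assume ?rhs
    then show "\<exists>h k. 0 < h \<and> 0 < k \<and> h + k = 2 * n
      \<and> coprime h (6 * prime_prod n) \<and> coprime k (6 * prime_prod n)"
    proof (elim disjE exE conjE)
      assume prime: "prime (2 * n - 1)"
      \<comment> \<open>The coprimality criterion also asks that the prime \<open>2 * n - 1\<close>
        exceed \<open>sqrt (2 * n)\<close>. The intermediate value \<open>2 * (2 * n - 1)\<close>
        works because 2 \<le> 2n - 1.\<close>
      have "real (2 * n) < (real (2 * n - 1))\<^sup>2"
      proof -
        have "2 * n < 2 * (2 * n - 1)" using assms by simp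
        also have "\<dots> \<le> (2 * n - 1) * (2 * n - 1)" using assms by (intro mult_le_mono1) simp
        finally show ?thesis by (simp only: power2_eq_square of_nat_less_iff flip: of_nat_mult)
      qed
      then have "sqrt (real (2 * n)) < real (2 * n - 1)"
        by (intro real_less_lsqrt) auto
      with prime have "coprime (2 * n - 1) (6 * prime_prod n)"
        using assms by (intro coprime_iff[THEN iffD2]) simp_all
      then show ?thesis
        using assms by (intro exI[of _ 1] exI[of _ "2 * n - 1"]) auto
    next
      fix q1 q2 :: nat
      assume q: "prime q1" "prime q2" "real q1 > sqrt (real (2 * n))"
        "real q2 > sqrt (real (2 * n))" "q1 + q2 = 2 * n"
      have pos: "0 < q1" "0 < q2" using q(1,2) prime_gt_0_nat by auto
      \<comment> \<open>Positivity of each prime makes the other one smaller than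
        \<open>2 * n\<close>, as the criterion requires.\<close>
      then have "coprime q1 (6 * prime_prod n)" "coprime q2 (6 * prime_prod n)"
        using q by (intro coprime_iff[THEN iffD2]; simp)+
      with pos q(5) show ?thesis by blast
    qed
  qed
qed

end
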